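(* Any set $\mathscr A$ of affects relations containing an affects causal loop of type 6a (ACL6a) can only arise from a cyclic causal structure. That is: if a causal model over a finite set $S$ with causal structure $\mathcal G$ is such that all affects relations in $\mathscr A$ hold in it (those designated irreducible being irreducible), and $\mathscr A$ contains an ACL6a, then $\mathcal G$ contains a directed cycle.
   Context: Causal structure. A causal structure is a directed graph $\mathcal G$ whose nodes are either observed or unobserved; the observed nodes form a finite set $S$ of (discrete) random variables, while unobserved nodes may be arbitrary systems (classical, quantum, or of a generalized probabilistic theory). For disjoint node sets, $X$ and $Y$ are d-separated by $Z$ if every undirected path between an element of $X$ and an element of $Y$ is blocked by $Z$, i.e. contains a segment $A\to V\to B$ or $A\leftarrow V\to B$ with $V\in Z$, or a collider $A\to V\leftarrow B$ such that neither $V$ nor any descendant of $V$ is in $Z$. A distribution over the observed nodes is compatible with the graph if d-separation of disjoint observed sets $X,Y$ by observed $Z$ implies $P(XY|Z)=P(X|Z)P(Y|Z)$. Causal model and interventions. A causal model over $S$ is such a graph $\mathcal G$ with a compatible distribution $P_{\mathcal G}$ over $S$, together with intervention data: for $X\subseteq S$, the augmented graph $\mathcal G_{I_X}$ adds for each $e\in X$ a parentless observed node $I_e$ with an edge $I_e\to e$ (values: "idle", or $\mathrm{do}(x)$ for values $x$ of $e$), and $\mathcal G_{\mathrm{do}(X)}$ is obtained from $\mathcal G_{I_X}$ by deleting all edges into $X$ other than those from $I_X$. Both carry compatible distributions with $P_{\mathcal G_{I_X}}(\cdot|I_X=\text{idle})=P_{\mathcal G}(\cdot)$, $P_{\mathcal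 G_{I_X}}(\cdot|I_X=\mathrm{do}(x))=P_{\mathcal G_{\mathrm{do}(X)}}(\cdot|I_X=\mathrm{do}(x))=P_{\mathcal G_{\mathrm{do}(X)}}(\cdot|X=x)$, and $I_X=\mathrm{do}(x)$ forces $X=x$. The same construction is applied to post-intervention models $\mathcal G_{\mathrm{do}(Z)}$ (intervening on $X$ there gives $\mathcal G_{\mathrm{do}(X\cup Z)}$). Affects relations (here without conditioning). For pairwise disjoint $X,Y,Z\subseteq S$ with $X,Y$ non-empty, $X\models Y\mid\mathrm{do}(Z)$ holds if there exist values $x,z$ with $P_{\mathcal G_{\mathrm{do}(X\cup Z)}}(Y| X=x,Z=z)\neq P_{\mathcal G_{\mathrm{do}(Z)}}(Y| Z=z)$; $X\models Y$ is the case $Z=\emptyset$. $X\models Y$ is reducible if $s_X\not\models Y\mid\mathrm{do}(X\setminus s_X)$ for some non-empty $s_X\subsetneq X$, and irreducible otherwise. Complete affects chains. $\mathscr A$ contains a complete affects chain from $S_1$ to $S_n$ ($n\ge2$) if there are non-empty sets $S_i\subseteq\hat S_i\subseteq S$ such that $\hat S_i\models S_{i+1}$ is in $\mathscr A$ and irreducible for all $1\le i<n$. ACL6a. Given $S_1$, define inductively (only finitely many applications allowed) when a non-empty set $T\subseteq S$ "returns to $S_1$": for each $e\in T$ there is in $\mathscr A$ a complete affects chain from $\{e\}$ either to some non-empty $s_1\subseteq S_1$, or to some set $T'$ disjoint from $T$ which itself returns to $S_1$. $\mathscr A$ contains an ACL6a if there are sets $S_1,S_2$ with a complete affects chain from $S_1$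 to $S_2$ in $\mathscr A$ such that $S_2$ returns to $S_1$. *)

theory Defs
  imports "HOL-Probability.Probability"
begin

subsection \<open>d-separation and compatibility\<close>

text \<open>An undirected path is its list of pairwise distinct nodes together with the direction in which
  each edge is traversed: \<open>fwd ! i\<close> says that the \<open>i\<close>-th edge points from \<open>ns ! i\<close> to \<open>ns ! Suc i\<close>.
  The directions are part of the path because in a cyclic graph both \<open>a \<rightarrow> b\<close> and \<open>b \<rightarrow> a\<close> may be
  edges.\<close>

definition undirected_path :: "('n \<times> 'n) set \<Rightarrow> 'n list \<Rightarrow> bool list \<Rightarrow> bool" where
  "undirected_path E ns fwd \<longleftrightarrow>
     length ns = Suc (length fwd) \<and> distinct ns \<and>
     (\<forall>i<length fwd. if fwd ! i then (ns ! i, ns ! Suc i) \<in> E else (ns ! Suc i, ns ! i) \<in> E)"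

text \<open>The inner node \<open>ns ! Suc i\<close> is a collider iff the edge before it points forwards and the edge
  after it points backwards; otherwise it is the middle of a chain or of a fork.\<close>

definition blocked :: "('n \<times> 'n) set \<Rightarrow> 'n set \<Rightarrow> 'n list \<Rightarrow> bool list \<Rightarrow> bool" where
  "blocked E C ns fwd \<longleftrightarrow>
     (\<exists>i. Suc i < length fwd \<and>
        (if fwd ! i \<and> \<not> fwd ! Suc i
         then \<forall>w. (ns ! Suc i, w) \<in> E\<^sup>* \<longrightarrow> w \<notin> C
         else ns ! Suc i \<in> C))"

definition d_separated :: "('n \<times> 'n) set \<Rightarrow> 'n set \<Rightarrow> 'n set \<Rightarrow> 'n set \<Rightarrow> bool" where
  "d_separated E A B C \<longleftrightarrow>
     (\<forall>ns fwd. undirected_path E ns fwd \<and> hd ns \<in> A \<and> last ns \<in> B \<longrightarrow> blocked E C ns fwd)"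

definition agree :: "'n set \<Rightarrow> ('n \<Rightarrow> 'o) \<Rightarrow> ('n \<Rightarrow> 'o) \<Rightarrow> bool" where
  "agree A a \<omega> \<longleftrightarrow> (\<forall>n\<in>A. \<omega> n = a n)"

text \<open>\<open>N\<close> is the set of observed nodes. Conditional probabilities given a null event are \<open>0\<close>, so the
  equation below only says something about those values of \<open>C\<close> that have positive probability.\<close>

definition compatible :: "('n \<times> 'n) set \<Rightarrow> 'n set \<Rightarrow> ('n \<Rightarrow> 'o) pmf \<Rightarrow> bool" where
  "compatible E N p \<longleftrightarrow>
     (\<forall>A B C. A \<subseteq> N \<and> B \<subseteq> N \<and> C \<subseteq> N \<and> A \<inter> B = {} \<and> A \<inter> C = {} \<and> B \<inter> C = {} \<and>
        d_separated E A B C \<longrightarrow>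
        (\<forall>a. \<P>(\<omega> in measure_pmf p. agree A a \<omega> \<and> agree B a \<omega> \<bar> agree C a \<omega>) =
             \<P>(\<omega> in measure_pmf p. agree A a \<omega> \<bar> agree C a \<omega>) *
             \<P>(\<omega> in measure_pmf p. agree B a \<omega> \<bar> agree C a \<omega>)))"


subsection \<open>Causal models and interventions\<close>

datatype 'v node = Var 'v | Intv 'v

datatype 'a outcome = Val 'a | Idle | Do 'a

text \<open>\<open>add_intv X E\<close> are the edges of the augmented graph obtained by attaching a node
  \<open>Intv e\<close> to every \<open>e \<in> X\<close>; \<open>do_edges X E\<close> are the edges of the post-intervention graph.\<close>

definition lift_edges :: "('v \<times> 'v) set \<Rightarrow> ('v node \<times> 'v node) set" where
  "lift_edges E = {(Var a, Var b) | a b. (a, b) \<in> E}"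

definition add_intv :: "'v set \<Rightarrow> ('v node \<times> 'v node) set \<Rightarrow> ('v node \<times> 'v node) set" where
  "add_intv X F = F \<union> {(Intv e, Var e) | e. e \<in> X}"

definition do_edges :: "'v set \<Rightarrow> ('v \<times> 'v) set \<Rightarrow> ('v node \<times> 'v node) set" where
  "do_edges X E = {(m, n) \<in> add_intv X (lift_edges E). n \<in> Var ` X \<longrightarrow> m \<in> Intv ` X}"

text \<open>\<open>P_do M Z\<close> is the distribution of the post-intervention model \<open>G_do(Z)\<close>, in particular
  \<open>P_do M {}\<close> is the distribution of \<open>G\<close> itself. \<open>P_aug M Z X\<close> is the distribution
  of the augmented graph \<open>(G_do(Z))_(I_X)\<close>, in particular \<open>P_aug M {} X\<close> belongs to
  \<open>G_(I_X)\<close>. Nodes in \<open>verts M - obs M\<close> are unobserved.\<close>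

record ('v, 'a) causal_model =
  verts :: "'v set"
  obs :: "'v set"
  edges :: "('v \<times> 'v) set"
  vals :: "'v \<Rightarrow> 'a set"
  P_do :: "'v set \<Rightarrow> ('v node \<Rightarrow> 'a outcome) pmf"
  P_aug :: "'v set \<Rightarrow> 'v set \<Rightarrow> ('v node \<Rightarrow> 'a outcome) pmf"

fun outcomes :: "('v, 'a) causal_model \<Rightarrow> 'v node \<Rightarrow> 'a outcome set" where
  "outcomes M (Var e) = Val ` vals M e"
| "outcomes M (Intv e) = insert Idle (Do ` vals M e)"

definition observed_nodes :: "('v, 'a) causal_model \<Rightarrow> 'v set \<Rightarrow> 'v node set" where
  "observed_nodes M W = Var ` obs M \<union> Intv ` W"

definition has_val :: "'v set \<Rightarrow> ('v \<Rightarrow> 'a) \<Rightarrow> ('v node \<Rightarrow> 'a outcome) \<Rightarrow> bool" where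
  "has_val X x \<omega> \<longleftrightarrow> (\<forall>e\<in>X. \<omega> (Var e) = Val (x e))"

definition intv_do :: "'v set \<Rightarrow> ('v \<Rightarrow> 'a) \<Rightarrow> ('v node \<Rightarrow> 'a outcome) \<Rightarrow> bool" where
  "intv_do X x \<omega> \<longleftrightarrow> (\<forall>e\<in>X. \<omega> (Intv e) = Do (x e))"

definition intv_idle :: "'v set \<Rightarrow> ('v node \<Rightarrow> 'a outcome) \<Rightarrow> bool" where
  "intv_idle X \<omega> \<longleftrightarrow> (\<forall>e\<in>X. \<omega> (Intv e) = Idle)"

definition is_distribution ::
  "('v, 'a) causal_model \<Rightarrow> 'v set \<Rightarrow> ('v node \<times> 'v node) set \<Rightarrow> ('v node \<Rightarrow> 'a outcome) pmf \<Rightarrow> bool" where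
  "is_distribution M W F p \<longleftrightarrow>
     set_pmf p \<subseteq> PiE (observed_nodes M W) (outcomes M) \<and> compatible F (observed_nodes M W) p"

text \<open>The conditions linking the model \<open>G_do(Z)\<close> with its augmentation by \<open>I_X\<close> and with
  \<open>G_do(X \<union> Z)\<close>. The equations between distributions concern the variables in \<open>obs M\<close>
  (as \<open>obs M\<close> is finite and the variables are discrete, point probabilities suffice). The
  positivity conditions make all conditional probabilities occurring here well-defined; nothing is
  required about the probability of \<open>Idle\<close> in \<open>G_do(X \<union> Z)\<close>.\<close>

definition intervention_consistent :: "('v, 'a) causal_model \<Rightarrow> 'v set \<Rightarrow> 'v set \<Rightarrow> bool" where
  "intervention_consistent M Z X \<longleftrightarrow>
     measure_pmf.prob (P_aug M Z X) {\<omega>. intv_idle X \<omega>} > 0 \<and>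
     (\<forall>s. \<P>(\<omega> in measure_pmf (P_aug M Z X). has_val (obs M) s \<omega> \<bar> intv_idle X \<omega>) =
          measure_pmf.prob (P_do M Z) {\<omega>. has_val (obs M) s \<omega>}) \<and>
     (\<forall>x\<in>Pi X (vals M).
        measure_pmf.prob (P_aug M Z X) {\<omega>. intv_do X x \<omega>} > 0 \<and>
        measure_pmf.prob (P_do M (X \<union> Z)) {\<omega>. intv_do X x \<omega>} > 0 \<and>
        (\<forall>\<omega>\<in>set_pmf (P_aug M Z X). intv_do X x \<omega> \<longrightarrow> has_val X x \<omega>) \<and>
        (\<forall>\<omega>\<in>set_pmf (P_do M (X \<union> Z)). intv_do X x \<omega> \<longrightarrow> has_val X x \<omega>) \<and>
        (\<forall>s. \<P>(\<omega> in measure_pmf (P_aug M Z X). has_val (obs M) s \<omega> \<bar> intv_do X x \<omega>) =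
             \<P>(\<omega> in measure_pmf (P_do M (X \<union> Z)). has_val (obs M) s \<omega> \<bar> intv_do X x \<omega>)) \<and>
        (\<forall>s. \<P>(\<omega> in measure_pmf (P_do M (X \<union> Z)). has_val (obs M) s \<omega> \<bar> intv_do X x \<omega>) =
             \<P>(\<omega> in measure_pmf (P_do M (X \<union> Z)). has_val (obs M) s \<omega> \<bar> has_val X x \<omega>)))"

definition is_causal_model :: "('v, 'a) causal_model \<Rightarrow> bool" where
  "is_causal_model M \<longleftrightarrow>
     finite (obs M) \<and> obs M \<subseteq> verts M \<and> edges M \<subseteq> verts M \<times> verts M \<and>
     (\<forall>e\<in>obs M. countable (vals M e)) \<and>
     (\<forall>Z\<subseteq>obs M. is_distribution M Z (do_edges Z (edges M)) (P_do M Z)) \<and>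
     (\<forall>Z\<subseteq>obs M. \<forall>X\<subseteq>obs M. X \<inter> Z = {} \<longrightarrow>
        is_distribution M (X \<union> Z) (add_intv X (do_edges Z (edges M))) (P_aug M Z X) \<and>
        intervention_consistent M Z X)"


subsection \<open>Affects relations\<close>

definition affects :: "('v, 'a) causal_model \<Rightarrow> 'v set \<Rightarrow> 'v set \<Rightarrow> 'v set \<Rightarrow> bool" where
  "affects M X Y Z \<longleftrightarrow>
     X \<subseteq> obs M \<and> Y \<subseteq> obs M \<and> Z \<subseteq> obs M \<and> X \<noteq> {} \<and> Y \<noteq> {} \<and>
     X \<inter> Y = {} \<and> X \<inter> Z = {} \<and> Y \<inter> Z = {} \<and>
     (\<exists>x\<in>Pi X (vals M). \<exists>z\<in>Pi Z (vals M). \<exists>y\<in>Pi Y (vals M).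
        \<P>(\<omega> in measure_pmf (P_do M (X \<union> Z)). has_val Y y \<omega> \<bar> has_val X x \<omega> \<and> has_val Z z \<omega>) \<noteq>
        \<P>(\<omega> in measure_pmf (P_do M Z). has_val Y y \<omega> \<bar> has_val Z z \<omega>))"

definition reducible :: "('v, 'a) causal_model \<Rightarrow> 'v set \<Rightarrow> 'v set \<Rightarrow> bool" where
  "reducible M X Y \<longleftrightarrow> affects M X Y {} \<and> (\<exists>s. s \<noteq> {} \<and> s \<subset> X \<and> \<not> affects M s Y (X - s))"

definition irreducible_affects :: "('v, 'a) causal_model \<Rightarrow> 'v set \<Rightarrow> 'v set \<Rightarrow> bool" where
  "irreducible_affects M X Y \<longleftrightarrow> affects M X Y {} \<and> \<not> reducible M X Y"

text \<open>The members of a set of affects relations are statements, detached from any model: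
  \<open>Aff X Y Z\<close> stands for \<open>X \<Turnstile> Y | do(Z)\<close>, and \<open>IrrAff X Y\<close> for \<open>X \<Turnstile> Y\<close> designated as irreducible.\<close>

datatype 'v affects_relation = Aff "'v set" "'v set" "'v set" | IrrAff "'v set" "'v set"

fun holds_in :: "('v, 'a) causal_model \<Rightarrow> 'v affects_relation \<Rightarrow> bool" where
  "holds_in M (Aff X Y Z) = affects M X Y Z"
| "holds_in M (IrrAff X Y) = irreducible_affects M X Y"


subsection \<open>Complete affects chains and causal loops of type 6a\<close>

text \<open>Below, \<open>S\<close> is the set of observed nodes and \<open>\<A>\<close> a set of affects relations over \<open>S\<close>.\<close>

definition complete_chain ::
  "'v set \<Rightarrow> 'v affects_relation set \<Rightarrow> 'v set \<Rightarrow> 'v set \<Rightarrow> bool" where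
  "complete_chain S \<A> A B \<longleftrightarrow>
     (\<exists>(n::nat) (T :: nat \<Rightarrow> 'v set) (T' :: nat \<Rightarrow> 'v set).
        2 \<le> n \<and> T 1 = A \<and> T n = B \<and>
        (\<forall>i\<in>{1..n}. T i \<noteq> {} \<and> T i \<subseteq> T' i \<and> T' i \<subseteq> S) \<and>
        (\<forall>i\<in>{1..<n}. IrrAff (T' i) (T (i + 1)) \<in> \<A>))"

inductive returns_to :: "'v set \<Rightarrow> 'v affects_relation set \<Rightarrow> 'v set \<Rightarrow> 'v set \<Rightarrow> bool"
  for S :: "'v set" and \<A> :: "'v affects_relation set" and S1 :: "'v set" where
  "T \<noteq> {} \<Longrightarrow>
   (\<And>e. e \<in> T \<Longrightarrow>
      (\<exists>s1. s1 \<noteq> {} \<and> s1 \<subseteq> S1 \<and> complete_chain S \<A> {e} s1) \<or>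
      (\<exists>T'. T' \<inter> T = {} \<and> complete_chain S \<A> {e} T' \<and> returns_to S \<A> S1 T')) \<Longrightarrow>
   returns_to S \<A> S1 T"

definition contains_ACL6a :: "'v set \<Rightarrow> 'v affects_relation set \<Rightarrow> bool" where
  "contains_ACL6a S \<A> \<longleftrightarrow>
     (\<exists>S1 S2. complete_chain S \<A> S1 S2 \<and> returns_to S \<A> S1 S2)"

end

theory Submission
  imports Defs
begin

text \<open>If \<open>Y\<close> contains no descendant of \<open>e\<close>, then in the graph of \<open>G_do(Z)\<close> augmented by \<open>I_e\<close> every
  path from \<open>I_e\<close> to \<open>Y\<close> has a first collider, and that collider has no descendant in \<open>Z\<close>. So \<open>I_e\<close>
  and \<open>Y\<close> are d-separated by \<open>Z\<close>, and conditioning on \<open>I_e = idle\<close> or \<open>I_e = do(x)\<close> makes no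
  difference: \<open>e\<close> does not affect \<open>Y\<close> given \<open>do(Z)\<close>. Contrapositively, every element of the left-hand
  side of an irreducible affects relation has a descendant in the right-hand side. Along the chains of
  an ACL6a this provides every element of \<open>S\<^sub>1\<close> with a descendant in \<open>S\<^sub>1\<close>, and as \<open>S\<^sub>1\<close> is finite and
  non-empty there is a cycle.\<close>

subsection \<open>d-separation in the augmented graph\<close>

lemma add_intv_do_edges_iff:
  "(m, n) \<in> add_intv X (do_edges Z E) \<longleftrightarrow>
     (\<exists>u v. m = Var u \<and> n = Var v \<and> (u, v) \<in> E \<and> v \<notin> Z) \<or> (\<exists>v\<in>X \<union> Z. m = Intv v \<and> n = Var v)"
  by (auto simp: add_intv_def do_edges_def lift_edges_def)

text \<open>In this graph the variables in \<open>Z\<close> are entered only from intervention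
  nodes, and those have no incoming edges. Hence a variable outside \<open>Z\<close> has no
  descendant in \<open>Z\<close>, which keeps every collider there blocked.\<close>

lemma rtrancl_add_intv_do_edges_from_Var:
  assumes "(Var u, w) \<in> (add_intv X (do_edges Z E))\<^sup>*"
  shows "w = Var u \<or> w \<notin> Var ` Z"
  using assms
proof (induction rule: rtrancl_induct)
  case (step m n)
  have "m \<in> range Var"
    using step.hyps(1) by (induction rule: rtrancl_induct) (auto simp: add_intv_do_edges_iff)
  then show ?case
    using step.hyps(2) by (auto simp: add_intv_do_edges_iff)
qed auto

text \<open>Induction along the path. \<open>Intv e\<close> has no incoming edge, so the path starts
  towards \<open>e\<close>. Turning backwards at a variable outside \<open>Z\<close> would create a
  collider without descendant in \<open>Z\<close>, and a forward edge out of a variable never ends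
  in \<open>Z\<close>.\<close>

lemma not_blocked_path_from_Intv_is_directed:
  assumes path: "undirected_path (add_intv X (do_edges Z E)) ns fwd"
    and start: "hd ns = Intv e"
    and nb: "\<not> blocked (add_intv X (do_edges Z E)) (Var ` Z) ns fwd"
    and e: "e \<notin> Z"
    and i: "i < length fwd"
  shows "fwd ! i \<and> (\<exists>v. ns ! Suc i = Var v \<and> v \<notin> Z \<and> (e, v) \<in> E\<^sup>*)"
  using i
proof (induction i)
  case 0
  have "ns ! 0 = Intv e"
    using path start by (cases ns) (auto simp: undirected_path_def)
  moreover have "if fwd ! 0 then (ns ! 0, ns ! Suc 0) \<in> add_intv X (do_edges Z E)
      else (ns ! Suc 0, ns ! 0) \<in> add_intv X (do_edges Z E)"
    using path 0 by (auto simp: undirected_path_def)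
  ultimately show ?case
    using e by (auto simp: add_intv_do_edges_iff split: if_splits)
next
  case (Suc i)
  then obtain v where v: "fwd ! i" "ns ! Suc i = Var v" "v \<notin> Z" "(e, v) \<in> E\<^sup>*"
    using e by auto
  have edge: "if fwd ! Suc i then (ns ! Suc i, ns ! Suc (Suc i)) \<in> add_intv X (do_edges Z E)
      else (ns ! Suc (Suc i), ns ! Suc i) \<in> add_intv X (do_edges Z E)"
    using path Suc.prems by (auto simp: undirected_path_def)
  have fwd: "fwd ! Suc i"
  proof (rule ccontr)
    assume "\<not> fwd ! Suc i"
    then obtain w where "(Var v, w) \<in> (add_intv X (do_edges Z E))\<^sup>*" "w \<in> Var ` Z"
      using nb Suc.prems v(1,2) unfolding blocked_def by (auto dest!: spec[of _ i])
    then show False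
      using rtrancl_add_intv_do_edges_from_Var v(3) by fastforce
  qed
  then obtain v' where "ns ! Suc (Suc i) = Var v'" "(v, v') \<in> E" "v' \<notin> Z"
    using edge v(2) by (auto simp: add_intv_do_edges_iff)
  then show ?case
    using fwd v(4) by (auto intro: rtrancl_into_rtrancl)
qed

lemma d_separated_Intv:
  assumes "e \<notin> Z" "\<And>y. y \<in> Y \<Longrightarrow> (e, y) \<notin> E\<^sup>*"
  shows "d_separated (add_intv X (do_edges Z E)) {Intv e} (Var ` Y) (Var ` Z)"
  unfolding d_separated_def
proof (intro allI impI, elim conjE, rule ccontr)
  fix ns fwd
  assume path: "undirected_path (add_intv X (do_edges Z E)) ns fwd"
    and start: "hd ns \<in> {Intv e}" and stop: "last ns \<in> Var ` Y"
    and nb: "\<not> blocked (add_intv X (do_edges Z E)) (Var ` Z) ns fwd"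
  have len: "length ns = Suc (length fwd)"
    using path by (simp add: undirected_path_def)
  show False
  proof (cases "length fwd")
    \<comment> \<open>A path without edges would identify \<open>Intv e\<close> with a
      \<open>Var\<close> node.\<close>
    case 0
    then show False
      using len start stop by (auto simp: length_Suc_conv)
  next
    case (Suc k)
    then have "last ns = ns ! Suc k"
      using len by (subst last_conv_nth) auto
    then show False
      using not_blocked_path_from_Intv_is_directed[OF path _ nb assms(1), of k] start stop Suc assms(2)
      by fastforce
  qed
qed

subsection \<open>Affects relations and descendants\<close>

lemma cond_prob_pmf:
  "cond_prob (measure_pmf p) P Q = measure_pmf.prob p {\<omega>. P \<omega> \<and> Q \<omega>} / measure_pmf.prob p {\<omega>. Q \<omega>}"
  by (simp add: cond_prob_def)

text \<open>Turns a conditional probability into an unconditional one of another pmf, so that facts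
  about marginals carry over to conditional distributions.\<close>

lemma prob_cond_pmf:
  assumes "measure_pmf.prob p {\<omega>. Q \<omega>} > 0"
  shows "measure_pmf.prob (cond_pmf p {\<omega>. Q \<omega>}) {\<omega>. P \<omega>} = cond_prob (measure_pmf p) P Q"
    and "set_pmf (cond_pmf p {\<omega>. Q \<omega>}) \<subseteq> set_pmf p"
proof -
  have ne: "set_pmf p \<inter> {\<omega>. Q \<omega>} \<noteq> {}"
    using assms measure_pmf_zero_iff[of p "{\<omega>. Q \<omega>}"] by auto
  show "set_pmf (cond_pmf p {\<omega>. Q \<omega>}) \<subseteq> set_pmf p"
    using set_cond_pmf[OF ne] by auto
  show "measure_pmf.prob (cond_pmf p {\<omega>. Q \<omega>}) {\<omega>. P \<omega>} = cond_prob (measure_pmf p) P Q"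
    using assms
    by (simp add: cond_pmf.rep_eq[OF ne] cond_prob_pmf measure_uniform_measure
        measure_pmf.emeasure_eq_measure Collect_conj_eq Int_commute)
qed

text \<open>The consistency conditions of a model speak about full assignments to
  \<open>obs M\<close> only, whereas affects relations concern subsets. Equal point probabilities on
  \<open>N\<close> force equal distributions of the \<open>N\<close>-variables, hence equal
  marginals.\<close>

lemma prob_has_val_cong:
  assumes p: "\<And>\<omega> e. \<omega> \<in> set_pmf p \<Longrightarrow> e \<in> N \<Longrightarrow> \<omega> (Var e) \<in> range Val"
    and q: "\<And>\<omega> e. \<omega> \<in> set_pmf q \<Longrightarrow> e \<in> N \<Longrightarrow> \<omega> (Var e) \<in> range Val"
    and eq: "\<And>s. measure_pmf.prob p {\<omega>. has_val N s \<omega>} = measure_pmf.prob q {\<omega>. has_val N s \<omega>}"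
    and "Y \<subseteq> N"
  shows "measure_pmf.prob p {\<omega>. has_val Y y \<omega>} = measure_pmf.prob q {\<omega>. has_val Y y \<omega>}"
proof -
  \<comment> \<open>\<open>r\<close> forgets everything but the variables in \<open>N\<close>, in
    particular the intervention nodes, in which \<open>p\<close> and \<open>q\<close> may
    differ.\<close>
  define r where "r = (\<lambda>\<omega> :: 'a node \<Rightarrow> 'b outcome. restrict (\<lambda>e. \<omega> (Var e)) N)"
  have pmf_r: "pmf (map_pmf r p') g = measure_pmf.prob p' {\<omega>. r \<omega> = g}" for p' g
    by (simp add: pmf_map vimage_def)
  have "map_pmf r p = map_pmf r q"
  proof (rule pmf_eqI)
    fix g
    show "pmf (map_pmf r p) g = pmf (map_pmf r q) g"
    proof (cases "\<exists>s. g = restrict (\<lambda>e. Val (s e)) N")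
      case True
      then obtain s where "g = restrict (\<lambda>e. Val (s e)) N" by blast
      then have "r \<omega> = g \<longleftrightarrow> has_val N s \<omega>" for \<omega>
        by (auto simp: r_def has_val_def restrict_def fun_eq_iff)
      then show ?thesis
        using eq by (simp add: pmf_r)
    next
      case False
      \<comment> \<open>A \<open>g\<close> that does not come from an assignment of values has
        probability zero on both sides.\<close>
      have "g \<notin> set_pmf (map_pmf r p')"
        if "\<And>\<omega> e. \<omega> \<in> set_pmf p' \<Longrightarrow> e \<in> N \<Longrightarrow> \<omega> (Var e) \<in> range Val" for p'
      proof
        assume "g \<in> set_pmf (map_pmf r p')"
        then obtain \<omega> where \<omega>: "\<omega> \<in> set_pmf p'" "g = r \<omega>" by auto
        then have "\<forall>e\<in>N. \<exists>a. \<omega> (Var e) = Val a"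
          using that by blast
        then obtain s where "\<forall>e\<in>N. \<omega> (Var e) = Val (s e)"
          by metis
        then have "g = restrict (\<lambda>e. Val (s e)) N"
          using \<omega>(2) by (auto simp: r_def)
        then show False
          using False by blast
      qed
      then have "g \<notin> set_pmf (map_pmf r p)" "g \<notin> set_pmf (map_pmf r q)"
        using p q by blast+
      then show ?thesis
        by (simp only: set_pmf_iff not_not)
    qed
  qed
  moreover have "measure_pmf.prob p' {\<omega>. has_val Y y \<omega>}
      = measure_pmf.prob (map_pmf r p') {g. \<forall>e\<in>Y. g e = Val (y e)}" for p'
  proof -
    have "r -` {g. \<forall>e\<in>Y. g e = Val (y e)} = {\<omega>. has_val Y y \<omega>}"
      using \<open>Y \<subseteq> N\<close> by (auto simp: r_def has_val_def)
    then show ?thesis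
      by simp
  qed
  ultimately show ?thesis
    by (simp only:)
qed

lemma cond_prob_has_val_cong:
  assumes p: "\<And>\<omega> e. \<omega> \<in> set_pmf p \<Longrightarrow> e \<in> N \<Longrightarrow> \<omega> (Var e) \<in> range Val"
    and q: "\<And>\<omega> e. \<omega> \<in> set_pmf q \<Longrightarrow> e \<in> N \<Longrightarrow> \<omega> (Var e) \<in> range Val"
    and P: "measure_pmf.prob p {\<omega>. P \<omega>} > 0"
    and Q: "measure_pmf.prob q {\<omega>. Q \<omega>} > 0"
    and eq: "\<And>s. cond_prob (measure_pmf p) (has_val N s) P = cond_prob (measure_pmf q) (has_val N s) Q"
    and "Y \<subseteq> N"
  shows "cond_prob (measure_pmf p) (has_val Y y) P = cond_prob (measure_pmf q) (has_val Y y) Q"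
proof -
  have "measure_pmf.prob (cond_pmf p {\<omega>. P \<omega>}) {\<omega>. has_val Y y \<omega>}
      = measure_pmf.prob (cond_pmf q {\<omega>. Q \<omega>}) {\<omega>. has_val Y y \<omega>}"
  proof (rule prob_has_val_cong[OF _ _ _ \<open>Y \<subseteq> N\<close>])
    show "\<omega> (Var e) \<in> range Val" if "\<omega> \<in> set_pmf (cond_pmf p {\<omega>. P \<omega>})" "e \<in> N" for \<omega> e
      using that p prob_cond_pmf(2)[of p P, OF P] by blast
    show "\<omega> (Var e) \<in> range Val" if "\<omega> \<in> set_pmf (cond_pmf q {\<omega>. Q \<omega>})" "e \<in> N" for \<omega> e
      using that q prob_cond_pmf(2)[of q Q, OF Q] by blast
  qed (simp add: prob_cond_pmf(1)[of _ P, OF P] prob_cond_pmf(1)[of _ Q, OF Q] eq)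
  then show ?thesis
    by (simp add: prob_cond_pmf(1)[of _ P, OF P] prob_cond_pmf(1)[of _ Q, OF Q])
qed

lemma is_distribution_range_Val:
  assumes "is_distribution M W F p" "\<omega> \<in> set_pmf p" "e \<in> obs M"
  shows "\<omega> (Var e) \<in> range Val"
proof -
  have "\<omega> (Var e) \<in> outcomes M (Var e)"
    using assms unfolding is_distribution_def observed_nodes_def by blast
  then show ?thesis
    by auto
qed

lemma causal_modelD:
  assumes "is_causal_model M" "Z \<subseteq> obs M"
  shows "is_distribution M Z (do_edges Z (edges M)) (P_do M Z)"
    and "X \<subseteq> obs M \<Longrightarrow> X \<inter> Z = {} \<Longrightarrow>
      is_distribution M (X \<union> Z) (add_intv X (do_edges Z (edges M))) (P_aug M Z X)"
    and "X \<subseteq> obs M \<Longrightarrow> X \<inter> Z = {} \<Longrightarrow> intervention_consistent M Z X"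
  using assms by (simp_all add: is_causal_model_def)

lemma has_val_Un: "has_val (A \<union> B) x \<omega> \<longleftrightarrow> has_val A x \<omega> \<and> has_val B x \<omega>"
  by (auto simp: has_val_def)

text \<open>The event \<open>intv_do W w\<close> has positive probability and almost surely forces
  the values \<open>w\<close> on \<open>W\<close>.\<close>

lemma prob_do_has_val_pos:
  assumes M: "is_causal_model M" and W: "W \<subseteq> obs M" and w: "w \<in> Pi W (vals M)"
  shows "measure_pmf.prob (P_do M W) {\<omega>. has_val W w \<omega>} > 0"
proof -
  \<comment> \<open>With nothing intervened upon beforehand, intervening on \<open>W\<close> leads
    exactly to \<open>P_do M W\<close>.\<close>
  have "intervention_consistent M {} W"
    using W by (intro causal_modelD[OF M]) auto
  then have pos: "measure_pmf.prob (P_do M W) {\<omega>. intv_do W w \<omega>} > 0"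
    and val: "\<forall>\<omega>\<in>set_pmf (P_do M W). intv_do W w \<omega> \<longrightarrow> has_val W w \<omega>"
    using w by (auto simp: intervention_consistent_def)
  have "measure_pmf.prob (P_do M W) {\<omega>. intv_do W w \<omega>} \<le> measure_pmf.prob (P_do M W) {\<omega>. has_val W w \<omega>}"
    by (rule measure_pmf.finite_measure_mono_AE) (use val in \<open>auto simp: AE_measure_pmf_iff\<close>)
  then show ?thesis
    using pos by linarith
qed

text \<open>Divides the factorisation given \<open>C\<close> by the conditional probability of the
  \<open>A\<close>-event, which is positive by \<open>pos\<close>. The left-hand side is the
  probability of the \<open>B\<close>-event given both the \<open>C\<close>-event and the
  \<open>A\<close>-event.\<close>

lemma compatible_cond_prob_eq:
  assumes comp: "compatible F N p" and sub: "A \<subseteq> N" "B \<subseteq> N" "C \<subseteq> N"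
    and disj: "A \<inter> B = {}" "A \<inter> C = {}" "B \<inter> C = {}"
    and sep: "d_separated F A B C"
    and pos: "measure_pmf.prob p {\<omega>. agree C a \<omega> \<and> agree A a \<omega>} > 0"
  shows "measure_pmf.prob p {\<omega>. (agree B a \<omega> \<and> agree C a \<omega>) \<and> agree A a \<omega>}
      / measure_pmf.prob p {\<omega>. agree C a \<omega> \<and> agree A a \<omega>}
    = cond_prob (measure_pmf p) (agree B a) (agree C a)"
proof -
  have "measure_pmf.prob p {\<omega>. agree C a \<omega> \<and> agree A a \<omega>} \<le> measure_pmf.prob p {\<omega>. agree C a \<omega>}"
    by (rule measure_pmf.finite_measure_mono) auto
  then have "measure_pmf.prob p {\<omega>. agree C a \<omega>} > 0"
    using pos by linarith
  moreover have "\<P>(\<omega> in measure_pmf p. agree A a \<omega> \<and> agree B a \<omega> \<bar> agree C a \<omega>) =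
      \<P>(\<omega> in measure_pmf p. agree A a \<omega> \<bar> agree C a \<omega>) *
      \<P>(\<omega> in measure_pmf p. agree B a \<omega> \<bar> agree C a \<omega>)"
    using comp sub disj sep unfolding compatible_def by blast
  ultimately show ?thesis
    using pos by (simp add: cond_prob_pmf field_simps conj_ac)
qed

text \<open>Without such a descendant, both sides of the affects inequality equal the probability of
  \<open>Y\<close> given \<open>Z\<close> in the augmented model: one through
  \<open>Intv e = Do (w e)\<close>, the other through \<open>Intv e = Idle\<close>.\<close>

lemma affects_singleton_imp_descendant:
  assumes M: "is_causal_model M" and aff: "affects M {e} Y Z"
  shows "\<exists>y\<in>Y. (e, y) \<in> (edges M)\<^sup>+"
proof (rule ccontr)
  assume no: "\<not> ?thesis"
  from aff have e: "e \<in> obs M" "e \<notin> Y" "e \<notin> Z" and YZ: "Y \<subseteq> obs M" "Z \<subseteq> obs M" "Y \<inter> Z = {}"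
    by (auto simp: affects_def)
  obtain x z y where x: "x \<in> Pi {e} (vals M)" and z: "z \<in> Pi Z (vals M)"
    and ne: "\<P>(\<omega> in measure_pmf (P_do M ({e} \<union> Z)). has_val Y y \<omega> \<bar> has_val {e} x \<omega> \<and> has_val Z z \<omega>) \<noteq>
        \<P>(\<omega> in measure_pmf (P_do M Z). has_val Y y \<omega> \<bar> has_val Z z \<omega>)"
    using aff by (auto simp: affects_def)
  \<comment> \<open>Compatibility and consistency work with one assignment for all variables; as
    \<open>{e}\<close>, \<open>Y\<close> and \<open>Z\<close> are disjoint, \<open>x\<close>,
    \<open>y\<close> and \<open>z\<close> can be merged.\<close>
  define w where "w = (\<lambda>v. if v \<in> Y then y v else if v \<in> Z then z v else x v)"
  have w_vals: "w \<in> Pi Z (vals M)" "w \<in> Pi {e} (vals M)" "w \<in> Pi ({e} \<union> Z) (vals M)"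
    using x z e YZ by (auto simp: w_def Pi_iff)
  have w: "has_val Y y = has_val Y w" "has_val Z z = has_val Z w" "has_val {e} x = has_val {e} w"
    using e YZ by (auto simp: w_def has_val_def fun_eq_iff)
  define p q1 q0 where "p = P_aug M Z {e}" and "q1 = P_do M ({e} \<union> Z)" and "q0 = P_do M Z"
  define F where "F = add_intv {e} (do_edges Z (edges M))"
  have dist_p: "is_distribution M ({e} \<union> Z) F p" and cons: "intervention_consistent M Z {e}"
    unfolding p_def F_def using e YZ by (intro causal_modelD[OF M]; simp)+
  have dist_q: "is_distribution M ({e} \<union> Z) (do_edges ({e} \<union> Z) (edges M)) q1"
    "is_distribution M Z (do_edges Z (edges M)) q0"
    unfolding q1_def q0_def using e YZ by (intro causal_modelD[OF M]; simp)+
  note range_Val = is_distribution_range_Val[OF dist_p] is_distribution_range_Val[OF dist_q(1)]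
    is_distribution_range_Val[OF dist_q(2)]

  have q1_pos: "measure_pmf.prob q1 {\<omega>. has_val Z w \<omega> \<and> has_val {e} w \<omega>} > 0"
    using prob_do_has_val_pos[OF M _ w_vals(3)] e YZ unfolding has_val_Un
    by (simp add: q1_def conj_commute)
  have q0_pos: "measure_pmf.prob q0 {\<omega>. has_val Z w \<omega>} > 0"
    using prob_do_has_val_pos[OF M YZ(2) w_vals(1)] by (simp add: q0_def)
  have "measure_pmf.prob q1 {\<omega>. has_val Z w \<omega> \<and> has_val {e} w \<omega>} \<le> measure_pmf.prob q1 {\<omega>. has_val {e} w \<omega>}"
    by (rule measure_pmf.finite_measure_mono) auto
  then have q1_pos': "measure_pmf.prob q1 {\<omega>. has_val {e} w \<omega>} > 0"
    using q1_pos by linarith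

  have do_cons: "measure_pmf.prob (P_aug M Z {e}) {\<omega>. intv_do {e} w \<omega>} > 0"
    "\<forall>s. cond_prob (measure_pmf (P_aug M Z {e})) (has_val (obs M) s) (intv_do {e} w)
      = cond_prob (measure_pmf (P_do M ({e} \<union> Z))) (has_val (obs M) s) (intv_do {e} w)"
    "\<forall>s. cond_prob (measure_pmf (P_do M ({e} \<union> Z))) (has_val (obs M) s) (intv_do {e} w)
      = cond_prob (measure_pmf (P_do M ({e} \<union> Z))) (has_val (obs M) s) (has_val {e} w)"
    using bspec[OF conjunct2[OF conjunct2[OF cons[unfolded intervention_consistent_def]]] w_vals(2)]
    by - (elim conjE, assumption)+
  have do_pos: "measure_pmf.prob p {\<omega>. intv_do {e} w \<omega>} > 0"
    and idle_pos: "measure_pmf.prob p {\<omega>. intv_idle {e} \<omega>} > 0"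
    unfolding p_def
    by (fact do_cons(1)) (rule conjunct1[OF cons[unfolded intervention_consistent_def]])
  \<comment> \<open>Two consistency equations are chained: from the augmented to the
    post-intervention model, and there from \<open>I_e = do(x)\<close> to
    \<open>e = x\<close>.\<close>
  have do_eq: "cond_prob (measure_pmf p) (has_val W w) (intv_do {e} w)
      = cond_prob (measure_pmf q1) (has_val W w) (has_val {e} w)" if "W \<subseteq> obs M" for W
  proof (rule cond_prob_has_val_cong)
    fix s
    show "cond_prob (measure_pmf p) (has_val (obs M) s) (intv_do {e} w)
        = cond_prob (measure_pmf q1) (has_val (obs M) s) (has_val {e} w)"
      unfolding p_def q1_def by (rule trans[OF do_cons(2)[rule_format] do_cons(3)[rule_format]])
  qed (fact range_Val do_pos q1_pos' that)+
  \<comment> \<open>The unconditional distribution \<open>q0\<close> is conditioned on the certain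
    event, so that the same congruence lemma applies.\<close>
  have idle_eq: "cond_prob (measure_pmf p) (has_val W w) (intv_idle {e})
      = cond_prob (measure_pmf q0) (has_val W w) (\<lambda>_. True)" if "W \<subseteq> obs M" for W
  proof (rule cond_prob_has_val_cong)
    fix s
    show "cond_prob (measure_pmf p) (has_val (obs M) s) (intv_idle {e})
        = cond_prob (measure_pmf q0) (has_val (obs M) s) (\<lambda>_. True)"
      using cons unfolding intervention_consistent_def p_def q0_def by (simp add: cond_prob_pmf)
    show "measure_pmf.prob q0 {\<omega>. True} > 0"
      by simp
  qed (fact range_Val idle_pos that)+

  \<comment> \<open>The right-hand side does not mention \<open>c\<close>, so the outcomes
    \<open>Do (w e)\<close> and \<open>Idle\<close> can be compared.\<close>
  have ind: "measure_pmf.prob p {\<omega>. (has_val Y w \<omega> \<and> has_val Z w \<omega>) \<and> \<omega> (Intv e) = c}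
        / measure_pmf.prob p {\<omega>. has_val Z w \<omega> \<and> \<omega> (Intv e) = c}
      = cond_prob (measure_pmf p) (has_val Y w) (has_val Z w)"
    if "measure_pmf.prob p {\<omega>. has_val Z w \<omega> \<and> \<omega> (Intv e) = c} > 0" for c
  proof -
    define a where "a = (\<lambda>n. case n of Var v \<Rightarrow> Val (w v) | Intv v \<Rightarrow> c)"
    have a: "agree (Var ` V) a = has_val V w" "agree {Intv e} a = (\<lambda>\<omega>. \<omega> (Intv e) = c)" for V
      by (auto simp: agree_def has_val_def a_def fun_eq_iff)
    \<comment> \<open>The reflexive case is excluded by \<open>e \<notin> Y\<close>.\<close>
    have "(e, y) \<notin> (edges M)\<^sup>*" if "y \<in> Y" for y
      using no that e(2) by (auto simp: rtrancl_eq_or_trancl)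
    then have sep: "d_separated F {Intv e} (Var ` Y) (Var ` Z)"
      unfolding F_def using e(3) by (intro d_separated_Intv)
    have comp: "compatible F (observed_nodes M ({e} \<union> Z)) p"
      using dist_p by (simp add: is_distribution_def)
    have "measure_pmf.prob p {\<omega>. (agree (Var ` Y) a \<omega> \<and> agree (Var ` Z) a \<omega>) \<and> agree {Intv e} a \<omega>}
        / measure_pmf.prob p {\<omega>. agree (Var ` Z) a \<omega> \<and> agree {Intv e} a \<omega>}
      = cond_prob (measure_pmf p) (agree (Var ` Y) a) (agree (Var ` Z) a)"
      by (rule compatible_cond_prob_eq[OF comp _ _ _ _ _ _ sep])
        (use YZ that in \<open>auto simp: observed_nodes_def a\<close>)
    then show ?thesis
      by (simp add: a)
  qed

  \<comment> \<open>Consistency conditions on the intervention alone. Conditioning on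
    \<open>Z\<close> as well is recovered as the quotient of the cases \<open>Y \<union> Z\<close>
    and \<open>Z\<close>, where \<open>ratio\<close> cancels the normalisations.\<close>
  have do_Z: "measure_pmf.prob p {\<omega>. has_val Z w \<omega> \<and> intv_do {e} w \<omega>} / measure_pmf.prob p {\<omega>. intv_do {e} w \<omega>}
      = measure_pmf.prob q1 {\<omega>. has_val Z w \<omega> \<and> has_val {e} w \<omega>} / measure_pmf.prob q1 {\<omega>. has_val {e} w \<omega>}"
    and do_YZ: "measure_pmf.prob p {\<omega>. (has_val Y w \<omega> \<and> has_val Z w \<omega>) \<and> intv_do {e} w \<omega>}
        / measure_pmf.prob p {\<omega>. intv_do {e} w \<omega>}
      = measure_pmf.prob q1 {\<omega>. (has_val Y w \<omega> \<and> has_val Z w \<omega>) \<and> has_val {e} w \<omega>}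
        / measure_pmf.prob q1 {\<omega>. has_val {e} w \<omega>}"
    using do_eq[of Z] do_eq[of "Y \<union> Z"] YZ by (simp_all add: cond_prob_pmf has_val_Un)
  have idle_Z: "measure_pmf.prob p {\<omega>. has_val Z w \<omega> \<and> intv_idle {e} \<omega>} / measure_pmf.prob p {\<omega>. intv_idle {e} \<omega>}
      = measure_pmf.prob q0 {\<omega>. has_val Z w \<omega>}"
    and idle_YZ: "measure_pmf.prob p {\<omega>. (has_val Y w \<omega> \<and> has_val Z w \<omega>) \<and> intv_idle {e} \<omega>}
        / measure_pmf.prob p {\<omega>. intv_idle {e} \<omega>}
      = measure_pmf.prob q0 {\<omega>. has_val Y w \<omega> \<and> has_val Z w \<omega>}"
    using idle_eq[of Z] idle_eq[of "Y \<union> Z"] YZ by (simp_all add: cond_prob_pmf has_val_Un)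
  have ratio: "b / c = b' / c'" if "b / d = b' / d'" "c / d = c' / d'" "d > 0" "d' > 0"
    for b c d b' c' d' :: real
  proof -
    have "b / c = (b / d) / (c / d)"
      using that(3) by simp
    also have "\<dots> = (b' / d') / (c' / d')"
      by (simp only: that(1,2))
    also have "\<dots> = b' / c'"
      using that(4) by simp
    finally show ?thesis .
  qed
  \<comment> \<open>Positivity in the post-intervention model is carried back to the augmented one,
    as \<open>ind\<close> requires it there.\<close>
  have "measure_pmf.prob p {\<omega>. has_val Z w \<omega> \<and> intv_do {e} w \<omega>}
      / measure_pmf.prob p {\<omega>. intv_do {e} w \<omega>} > 0"
    unfolding do_Z by (rule divide_pos_pos[OF q1_pos q1_pos'])
  then have "measure_pmf.prob p {\<omega>. has_val Z w \<omega> \<and> intv_do {e} w \<omega>} > 0"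
    using do_pos by (simp only: zero_less_divide_iff) linarith
  then have "cond_prob (measure_pmf p) (has_val Y w) (has_val Z w)
      = measure_pmf.prob p {\<omega>. (has_val Y w \<omega> \<and> has_val Z w \<omega>) \<and> intv_do {e} w \<omega>}
        / measure_pmf.prob p {\<omega>. has_val Z w \<omega> \<and> intv_do {e} w \<omega>}"
    using ind[of "Do (w e)"] by (simp add: intv_do_def)
  also have "\<dots> = measure_pmf.prob q1 {\<omega>. (has_val Y w \<omega> \<and> has_val Z w \<omega>) \<and> has_val {e} w \<omega>}
      / measure_pmf.prob q1 {\<omega>. has_val Z w \<omega> \<and> has_val {e} w \<omega>}"
    by (rule ratio[OF do_YZ do_Z do_pos q1_pos'])
  finally have 1: "cond_prob (measure_pmf p) (has_val Y w) (has_val Z w)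
      = \<P>(\<omega> in measure_pmf q1. has_val Y y \<omega> \<bar> has_val {e} x \<omega> \<and> has_val Z z \<omega>)"
    by (simp add: cond_prob_pmf w conj_ac)
  have "measure_pmf.prob p {\<omega>. has_val Z w \<omega> \<and> intv_idle {e} \<omega>}
      / measure_pmf.prob p {\<omega>. intv_idle {e} \<omega>} > 0"
    unfolding idle_Z by (rule q0_pos)
  then have "measure_pmf.prob p {\<omega>. has_val Z w \<omega> \<and> intv_idle {e} \<omega>} > 0"
    using idle_pos by (simp only: zero_less_divide_iff) linarith
  then have "cond_prob (measure_pmf p) (has_val Y w) (has_val Z w)
      = measure_pmf.prob p {\<omega>. (has_val Y w \<omega> \<and> has_val Z w \<omega>) \<and> intv_idle {e} \<omega>}
        / measure_pmf.prob p {\<omega>. has_val Z w \<omega> \<and> intv_idle {e} \<omega>}"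
    using ind[of Idle] by (simp add: intv_idle_def)
  also have "\<dots> = measure_pmf.prob q0 {\<omega>. has_val Y w \<omega> \<and> has_val Z w \<omega>}
      / measure_pmf.prob q0 {\<omega>. has_val Z w \<omega>}"
    \<comment> \<open>\<open>d' = 1\<close> because nothing is conditioned on in
      \<open>q0\<close>.\<close>
    by (rule ratio[where d = "measure_pmf.prob p {\<omega>. intv_idle {e} \<omega>}" and d' = 1])
      (simp_all only: idle_Z idle_YZ idle_pos div_by_1 zero_less_one)
  also have "\<dots> = \<P>(\<omega> in measure_pmf q0. has_val Y y \<omega> \<bar> has_val Z z \<omega>)"
    by (simp add: cond_prob_pmf w)
  finally show False
    using 1 ne by (simp add: q1_def q0_def)
qed

text \<open>Irreducibility, tested on the subset \<open>{e}\<close>, makes \<open>e\<close> on its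
  own affect \<open>Y\<close> given \<open>do(X - {e})\<close>.\<close>

lemma irreducible_affects_imp_descendant:
  assumes "is_causal_model M" "irreducible_affects M X Y" "e \<in> X"
  shows "\<exists>y\<in>Y. (e, y) \<in> (edges M)\<^sup>+"
proof -
  have "affects M {e} Y (X - {e})"
  proof (cases "X = {e}")
    case True
    then show ?thesis
      using assms(2) by (simp add: irreducible_affects_def)
  next
    case False
    then have "{e} \<subset> X"
      using assms(3) by auto
    then show ?thesis
      using assms(2) unfolding irreducible_affects_def reducible_def by blast
  qed
  then show ?thesis
    by (rule affects_singleton_imp_descendant[OF assms(1)])
qed

subsection \<open>Chains and loops\<close>

text \<open>Provides what the final argument needs of \<open>S1\<close>: it is non-empty, and finite
  as a subset of \<open>obs M\<close>.\<close>

lemma complete_chain_source: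
  assumes "complete_chain S \<A> A B"
  shows "A \<noteq> {}" "A \<subseteq> S"
proof -
  obtain n :: nat and T T' where "2 \<le> n" "T 1 = A"
    and sub: "\<forall>i\<in>{1..n}. T i \<noteq> {} \<and> T i \<subseteq> T' i \<and> T' i \<subseteq> S"
    using assms unfolding complete_chain_def by - (elim exE conjE, rule that)
  then have "A \<noteq> {} \<and> A \<subseteq> T' 1 \<and> T' 1 \<subseteq> S"
    using bspec[OF sub, of 1] by simp
  then show "A \<noteq> {}" "A \<subseteq> S"
    by auto
qed

text \<open>Each \<open>T i\<close> lies inside the left-hand side \<open>T' i\<close> of an
  irreducible relation, so all its elements have descendants in the next set, and the links
  compose.\<close>

lemma complete_chain_imp_descendant:
  assumes M: "is_causal_model M" and holds: "\<forall>r\<in>\<A>. holds_in M r"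
    and chain: "complete_chain S \<A> A B" and a: "a \<in> A"
  shows "\<exists>b\<in>B. (a, b) \<in> (edges M)\<^sup>+"
proof -
  obtain n :: nat and T T' where n: "2 \<le> n" "T 1 = A" "T n = B"
    and sub: "\<forall>i\<in>{1..n}. T i \<noteq> {} \<and> T i \<subseteq> T' i \<and> T' i \<subseteq> S"
    and irr: "\<forall>i\<in>{1..<n}. IrrAff (T' i) (T (i + 1)) \<in> \<A>"
    using chain unfolding complete_chain_def by - (elim exE conjE, rule that)
  have link: "\<exists>y\<in>T (Suc i). (x, y) \<in> (edges M)\<^sup>+" if "1 \<le> i" "i < n" "x \<in> T i" for i x
  proof (rule irreducible_affects_imp_descendant[OF M])
    have "IrrAff (T' i) (T (i + 1)) \<in> \<A>"
      using irr that by simp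
    then show "irreducible_affects M (T' i) (T (Suc i))"
      using holds by fastforce
    show "x \<in> T' i"
      using sub that by fastforce
  qed
  \<comment> \<open>Starting at \<open>m = 2\<close> ensures at least one link, hence a path of
    positive length.\<close>
  have "\<exists>b\<in>T m. (a, b) \<in> (edges M)\<^sup>+" if "2 \<le> m" "m \<le> n" for m
    using that
  proof (induction m rule: dec_induct)
    case base
    then show ?case
      using link[of 1 a] n a by (simp add: numeral_2_eq_2)
  next
    case (step m)
    then obtain b where "b \<in> T m" "(a, b) \<in> (edges M)\<^sup>+"
      using Suc_leD by blast
    then show ?case
      using link[of m b] step.hyps step.prems by (meson Suc_le_eq one_le_numeral order_trans trancl_trans)
  qed
  then show ?thesis
    using n by auto
qed

text \<open>The chain from \<open>{e}\<close> reaches \<open>S1\<close> or some element of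
  \<open>T'\<close>; the induction hypothesis covers every element of \<open>T'\<close>, whichever
  is reached.\<close>

lemma returns_to_imp_descendant:
  assumes "is_causal_model M" "\<forall>r\<in>\<A>. holds_in M r" "returns_to S \<A> S1 T" "e \<in> T"
  shows "\<exists>s\<in>S1. (e, s) \<in> (edges M)\<^sup>+"
  using assms(3,4)
proof (induction arbitrary: e rule: returns_to.induct)
  case (1 T)
  note desc = complete_chain_imp_descendant[OF assms(1,2)]
  from 1(2)[OF 1(3)] show ?case
  proof (elim disjE exE conjE)
    fix s1 assume "s1 \<subseteq> S1" "complete_chain S \<A> {e} s1"
    then show ?thesis
      using desc by blast
  next
    fix T' assume "complete_chain S \<A> {e} T'"
      and IH: "\<forall>x. x \<in> T' \<longrightarrow> (\<exists>s\<in>S1. (x, s) \<in> (edges M)\<^sup>+)"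
    then obtain t where "t \<in> T'" "(e, t) \<in> (edges M)\<^sup>+"
      using desc by blast
    then show ?thesis
      using IH by (meson trancl_trans)
  qed
qed

text \<open>On a finite set the converse of an acyclic relation is well-founded; a minimal element
  for it is a sink. Taking \<open>r\<^sup>+\<close> allows paths that leave \<open>A\<close> in
  between.\<close>

lemma acyclic_imp_sink_in_finite_set:
  assumes "acyclic r" "finite A" "A \<noteq> {}"
  shows "\<exists>a\<in>A. \<forall>b\<in>A. (a, b) \<notin> r\<^sup>+"
proof -
  have "finite (r\<^sup>+ \<inter> A \<times> A)"
    using assms(2) by simp
  moreover have "acyclic (r\<^sup>+ \<inter> A \<times> A)"
    by (rule acyclic_subset[of "r\<^sup>+"]) (use assms(1) in \<open>simp_all add: acyclic_def\<close>)
  ultimately have "wf ((r\<^sup>+ \<inter> A \<times> A)\<inverse>)"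
    by (rule finite_acyclic_wf_converse)
  then obtain a where "a \<in> A" "\<And>b. (b, a) \<in> (r\<^sup>+ \<inter> A \<times> A)\<inverse> \<Longrightarrow> b \<notin> A"
    using wfE_min' assms(3) by metis
  then show ?thesis
    by blast
qed

theorem theorem2p49:
  fixes M :: "('v, 'a) causal_model"
    and \<A> :: "'v affects_relation set"
  assumes "is_causal_model M"
    and "\<forall>r\<in>\<A>. holds_in M r"
    and "contains_ACL6a (obs M) \<A>"
  shows "\<not> acyclic (edges M)"
proof
  assume acyc: "acyclic (edges M)"
  obtain S1 S2 where chain: "complete_chain (obs M) \<A> S1 S2" and ret: "returns_to (obs M) \<A> S1 S2"
    using assms(3) by (auto simp: contains_ACL6a_def)
  have "finite S1"
    using complete_chain_source(2)[OF chain] assms(1) by (auto simp: is_causal_model_def finite_subset)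
  then obtain a where a: "a \<in> S1" "\<forall>b\<in>S1. (a, b) \<notin> (edges M)\<^sup>+"
    using acyclic_imp_sink_in_finite_set[OF acyc _ complete_chain_source(1)[OF chain]] by blast
  \<comment> \<open>From the sink \<open>a\<close> the loop leads through \<open>b\<close> back into
    \<open>S1\<close>, against the choice of \<open>a\<close>.\<close>
  obtain b where "b \<in> S2" "(a, b) \<in> (edges M)\<^sup>+"
    using complete_chain_imp_descendant[OF assms(1,2) chain a(1)] by blast
  then show False
    using returns_to_imp_descendant[OF assms(1,2) ret] a(2) by (meson trancl_trans)
qed

end
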